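(* Let $X(u,v)=(f(u),g(u),\rho(u)\cos v,\rho(u)\sin v)$, $u\in I$, $v\in[0,2\pi)$, be a surface of revolution in $\mathbb R^4$ of type $[SR_1]$, generated by the arc-length parametrized curve $z(u)=(f(u),g(u),\rho(u),0)$ with $\rho>0$ on $I$, and let $K$ be its Gaussian curvature. Then $K$ is constant if and only if $\rho$ has the following form, according to the value of the constant (here $C\neq 0$ is a real constant): (1) $K=-C^2$ identically if and only if there are real constants $C_1,C_2$ with $\rho(u)=C_1e^{Cu}+C_2e^{-Cu}$ for all $u\in I$; (2) $K=C^2$ identically if and only if there are real constants $C_1,C_2$ with $\rho(u)=C_1\sin(Cu)+C_2\cos(Cu)$ for all $u\in I$; (3) $K=0$ identically if and only if there are real constants $C_1,C_2$ with $\rho(u)=C_1u+C_2$ for all $u\in I$; where in each case $C_1,C_2$ are such that $\rho(u)>0$ for each $u\in I$.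
   Context: $I\subset\mathbb R$ is an open interval and all functions are smooth. A surface of revolution of type $[SR_1]$ in Euclidean space $\mathbb R^4$ is defined as follows: let $z(u)=(f(u),g(u),\rho(u),0)$, $u\in I$, be a curve parametrized by arc-length, i.e. $(f')^2+(g')^2+(\rho')^2=1$, with $\rho(u)>0$. Rotating it by the orthogonal transformations that fix the first two coordinates and rotate the last two by the angle $v$ gives $X(u,v)=(f(u),g(u),\rho(u)\cos v,\rho(u)\sin v)$. The Gaussian curvature is that of the induced metric; for orthogonal coordinates with $E=\langle X_u,X_u\rangle>0$, $F=\langle X_u,X_v\rangle=0$, $G=\langle X_v,X_v\rangle>0$, and $e=\sqrt{E}$, $\gamma=\sqrt{G}$, it is $K=-\frac{1}{e\gamma}\left[\left(\frac{\gamma_u}{e}\right)_u+\left(\frac{e_v}{\gamma}\right)_v\right]$. *)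

theory Defs
  imports "HOL-Analysis.Analysis"
begin

text \<open>Since \<open>deriv\<close> is the two-sided derivative, this notion of smoothness is
  meant for open \<open>I\<close>.\<close>

definition smooth_fun_on :: "real set \<Rightarrow> (real \<Rightarrow> real) \<Rightarrow> bool" where
  "smooth_fun_on I f \<longleftrightarrow> (\<forall>n. \<forall>u\<in>I. (deriv ^^ n) f field_differentiable (at u))"

definition partial_u :: "(real \<Rightarrow> real \<Rightarrow> 'a::real_normed_vector) \<Rightarrow> real \<Rightarrow> real \<Rightarrow> 'a" where
  "partial_u X u v = vector_derivative (\<lambda>s. X s v) (at u)"

definition partial_v :: "(real \<Rightarrow> real \<Rightarrow> 'a::real_normed_vector) \<Rightarrow> real \<Rightarrow> real \<Rightarrow> 'a" where
  "partial_v X u v = vector_derivative (\<lambda>t. X u t) (at v)"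

definition first_E :: "(real \<Rightarrow> real \<Rightarrow> 'a::real_inner) \<Rightarrow> real \<Rightarrow> real \<Rightarrow> real" where
  "first_E X u v = partial_u X u v \<bullet> partial_u X u v"

definition first_F :: "(real \<Rightarrow> real \<Rightarrow> 'a::real_inner) \<Rightarrow> real \<Rightarrow> real \<Rightarrow> real" where
  "first_F X u v = partial_u X u v \<bullet> partial_v X u v"

definition first_G :: "(real \<Rightarrow> real \<Rightarrow> 'a::real_inner) \<Rightarrow> real \<Rightarrow> real \<Rightarrow> real" where
  "first_G X u v = partial_v X u v \<bullet> partial_v X u v"

text \<open>The Gaussian curvature of the induced metric
  \<open>e\<^sup>2 du\<^sup>2 + \<gamma>\<^sup>2 dv\<^sup>2\<close>, i.e.
  \<open>- ((\<gamma>\<^sub>u / e)\<^sub>u + (e\<^sub>v / \<gamma>)\<^sub>v) / (e \<gamma>)\<close>. It is the curvature only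
  for orthogonal coordinates (\<open>E > 0\<close>, \<open>F = 0\<close>, \<open>G > 0\<close>); for the surfaces
  \<open>SR1_surface\<close> this is lemma \<open>SR1_orthogonal\<close> below.\<close>

definition gaussian_curvature :: "(real \<Rightarrow> real \<Rightarrow> 'a::real_inner) \<Rightarrow> real \<Rightarrow> real \<Rightarrow> real" where
  "gaussian_curvature X u v =
    (let e = (\<lambda>s t. sqrt (first_E X s t)); \<gamma> = (\<lambda>s t. sqrt (first_G X s t))
     in - (1 / (e u v * \<gamma> u v)) *
          (partial_u (\<lambda>s t. partial_u \<gamma> s t / e s t) u v +
           partial_v (\<lambda>s t. partial_v e s t / \<gamma> s t) u v))"

text \<open>The angle ranges over all of \<open>\<real>\<close>, so that the \<open>v\<close>-derivatives are
  two-sided also at \<open>v = 0\<close>.\<close>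

definition SR1_surface ::
    "(real \<Rightarrow> real) \<Rightarrow> (real \<Rightarrow> real) \<Rightarrow> (real \<Rightarrow> real) \<Rightarrow> real \<Rightarrow> real \<Rightarrow> real ^ 4" where
  "SR1_surface f g \<rho> u v = vector [f u, g u, \<rho> u * cos v, \<rho> u * sin v]"

lemma vector_4_eq_axis:
  "(vector [a, b, c, d] :: real ^ 4) =
    a *\<^sub>R axis 1 1 + b *\<^sub>R axis 2 1 + c *\<^sub>R axis 3 1 + d *\<^sub>R axis 4 1"
  by (simp add: vec_eq_iff forall_4 vector_def axis_def)

lemma inner_vector_4:
  "(vector [a, b, c, d] :: real ^ 4) \<bullet> vector [a', b', c', d'] = a * a' + b * b' + c * c' + d * d'"
  by (simp add: inner_vec_def sum_4 vector_def)

lemma has_vector_derivative_vector_4: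
  assumes "(a has_real_derivative a') (at x)" "(b has_real_derivative b') (at x)"
    and "(c has_real_derivative c') (at x)" "(d has_real_derivative d') (at x)"
  shows "((\<lambda>x. vector [a x, b x, c x, d x] :: real ^ 4) has_vector_derivative
    vector [a', b', c', d']) (at x)"
  unfolding vector_4_eq_axis
  by (intro has_vector_derivative_add)
     (use assms in \<open>auto intro!: has_vector_derivative_scaleR[where g' = 0, simplified]\<close>)

lemma SR1_partials:
  assumes "f field_differentiable (at u)" "g field_differentiable (at u)"
    and "\<rho> field_differentiable (at u)"
  shows "partial_u (SR1_surface f g \<rho>) u v =
      vector [deriv f u, deriv g u, deriv \<rho> u * cos v, deriv \<rho> u * sin v]"
    and "partial_v (SR1_surface f g \<rho>) u v =
      vector [0, 0, - (\<rho> u * sin v), \<rho> u * cos v]"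
proof -
  have D: "(f has_real_derivative deriv f u) (at u)" "(g has_real_derivative deriv g u) (at u)"
      "(\<rho> has_real_derivative deriv \<rho> u) (at u)"
    using assms by (simp_all add: DERIV_deriv_iff_field_differentiable)
  show "partial_u (SR1_surface f g \<rho>) u v =
      vector [deriv f u, deriv g u, deriv \<rho> u * cos v, deriv \<rho> u * sin v]"
    unfolding partial_u_def SR1_surface_def
    by (rule vector_derivative_at, rule has_vector_derivative_vector_4)
       (auto intro!: derivative_eq_intros D)
  show "partial_v (SR1_surface f g \<rho>) u v =
      vector [0, 0, - (\<rho> u * sin v), \<rho> u * cos v]"
    unfolding partial_v_def SR1_surface_def
    by (rule vector_derivative_at, rule has_vector_derivative_vector_4)
       (auto intro!: derivative_eq_intros)
qed

lemma SR1_orthogonal: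
  assumes "f field_differentiable (at u)" "g field_differentiable (at u)"
    and "\<rho> field_differentiable (at u)"
    and "(deriv f u)\<^sup>2 + (deriv g u)\<^sup>2 + (deriv \<rho> u)\<^sup>2 = 1" and "\<rho> u > 0"
  shows "first_E (SR1_surface f g \<rho>) u v = 1"
    and "first_F (SR1_surface f g \<rho>) u v = 0"
    and "first_G (SR1_surface f g \<rho>) u v = (\<rho> u)\<^sup>2"
    and "first_G (SR1_surface f g \<rho>) u v > 0"
proof -
  have "first_E (SR1_surface f g \<rho>) u v =
      (deriv f u)\<^sup>2 + (deriv g u)\<^sup>2 + (deriv \<rho> u)\<^sup>2 * ((cos v)\<^sup>2 + (sin v)\<^sup>2)"
    unfolding first_E_def SR1_partials[OF assms(1-3)] inner_vector_4
    by algebra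
  then show "first_E (SR1_surface f g \<rho>) u v = 1"
    using assms(4) by simp
  show "first_F (SR1_surface f g \<rho>) u v = 0"
    unfolding first_F_def SR1_partials[OF assms(1-3)] inner_vector_4 by simp
  have "first_G (SR1_surface f g \<rho>) u v = (\<rho> u)\<^sup>2 * ((sin v)\<^sup>2 + (cos v)\<^sup>2)"
    unfolding first_G_def SR1_partials[OF assms(1-3)] inner_vector_4
    by algebra
  then show "first_G (SR1_surface f g \<rho>) u v = (\<rho> u)\<^sup>2" by simp
  then show "first_G (SR1_surface f g \<rho>) u v > 0" using assms(5) by simp
qed

end

theory Submission
  imports Defs
begin

text \<open>
  Because \<open>z\<close> is parametrized by arc length, the surface \<open>SR1_surface f g \<rho>\<close> carries the metric
  \<open>du\<^sup>2 + \<rho>\<^sup>2 dv\<^sup>2\<close>. Hence \<open>e = 1\<close> and \<open>\<gamma> = \<rho>\<close> over \<open>I\<close>, and the curvature is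
  \<open>K u v = - \<rho>'' u / \<rho> u\<close> (\<open>SR1_gaussian_curvature\<close>). Thus \<open>K\<close> takes the constant value \<open>k\<close> iff
  \<open>\<rho>'' = - k \<rho>\<close> on \<open>I\<close>. The solutions of this linear equation on an interval are found, according
  to the sign of \<open>k\<close>, by exhibiting two first integrals from which \<open>\<rho>\<close> is recovered by linear
  algebra (\<open>second_order_exp_iff\<close>, \<open>second_order_trig_iff\<close>, \<open>second_order_affine_iff\<close>). For the
  equivalence with constancy of \<open>K\<close>, a constant \<open>k \<noteq> 0\<close> is written as
  \<open>\<plusminus> C\<^sup>2\<close> with \<open>C = sqrt \<bar>k\<bar>\<close>.
\<close>

lemma smooth_fun_on_derivs:
  assumes "smooth_fun_on I f" "u \<in> I"
  shows "(f has_real_derivative deriv f u) (at u)"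
    and "(deriv f has_real_derivative deriv (deriv f) u) (at u)"
proof -
  have D: "(deriv ^^ n) f field_differentiable (at u)" for n
    using assms unfolding smooth_fun_on_def by blast
  show "(f has_real_derivative deriv f u) (at u)"
    using D[of 0] by (simp add: DERIV_deriv_iff_field_differentiable)
  show "(deriv f has_real_derivative deriv (deriv f) u) (at u)"
    using D[of 1] by (simp add: DERIV_deriv_iff_field_differentiable)
qed

lemma vector_derivative_eq_on_open:
  fixes F h :: "real \<Rightarrow> real"
  assumes "open I" "u \<in> I" "\<And>s. s \<in> I \<Longrightarrow> F s = h s"
    and "(h has_real_derivative d) (at u)"
  shows "vector_derivative F (at u) = d"
proof (rule vector_derivative_at)
  have "(F has_real_derivative d) (at u)"
    by (rule has_field_derivative_transform_within_open[OF assms(4,1,2)]) (simp add: assms(3))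
  then show "(F has_vector_derivative d) (at u)"
    by (simp add: has_real_derivative_iff_has_vector_derivative)
qed

lemma SR1_gaussian_curvature:
  assumes "open I" "u \<in> I"
    and f: "smooth_fun_on I f" and g: "smooth_fun_on I g" and \<rho>: "smooth_fun_on I \<rho>"
    and unit: "\<And>u. u \<in> I \<Longrightarrow> (deriv f u)\<^sup>2 + (deriv g u)\<^sup>2 + (deriv \<rho> u)\<^sup>2 = 1"
    and pos: "\<And>u. u \<in> I \<Longrightarrow> \<rho> u > 0"
  shows "gaussian_curvature (SR1_surface f g \<rho>) u v = - deriv (deriv \<rho>) u / \<rho> u"
proof -
  define e where "e = (\<lambda>s t. sqrt (first_E (SR1_surface f g \<rho>) s t))"
  define \<gamma> where "\<gamma> = (\<lambda>s t. sqrt (first_G (SR1_surface f g \<rho>) s t))"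
  have diff: "h field_differentiable (at s)" if "smooth_fun_on I h" "s \<in> I" for h s
    using smooth_fun_on_derivs(1)[OF that] by (auto simp: field_differentiable_def)
  note orth = SR1_orthogonal[OF diff[OF f] diff[OF g] diff[OF \<rho>] unit pos]
  have e: "e s t = 1" if "s \<in> I" for s t
    using orth(1) that by (simp add: e_def)
  have \<gamma>: "\<gamma> s t = \<rho> s" if "s \<in> I" for s t
    using orth(3) that pos[OF that] by (simp add: \<gamma>_def)
  have \<gamma>_u: "partial_u \<gamma> s t = deriv \<rho> s" if "s \<in> I" for s t
    unfolding partial_u_def
    by (rule vector_derivative_eq_on_open[OF \<open>open I\<close> that])
       (use \<gamma> smooth_fun_on_derivs(1)[OF \<rho> that] in auto)
  have 1: "partial_u (\<lambda>s t. partial_u \<gamma> s t / e s t) u v = deriv (deriv \<rho>) u"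
    unfolding partial_u_def[of "\<lambda>s t. partial_u \<gamma> s t / e s t"]
    by (rule vector_derivative_eq_on_open[OF \<open>open I\<close> \<open>u \<in> I\<close>])
       (use \<gamma>_u e smooth_fun_on_derivs(2)[OF \<rho> \<open>u \<in> I\<close>] in auto)
  have "e u = (\<lambda>_. 1)"
    using e[OF \<open>u \<in> I\<close>] by blast
  then have "partial_v e u t = 0" for t
    unfolding partial_v_def by simp
  then have 2: "partial_v (\<lambda>s t. partial_v e s t / \<gamma> s t) u v = 0"
    unfolding partial_v_def[of "\<lambda>s t. partial_v e s t / \<gamma> s t"] by simp
  show ?thesis
    unfolding gaussian_curvature_def Let_def e_def[symmetric] \<gamma>_def[symmetric]
    using 1 2 e[OF \<open>u \<in> I\<close>] \<gamma>[OF \<open>u \<in> I\<close>] by simp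
qed

lemma deriv_deriv_eq_on_open:
  fixes \<rho> h h' :: "real \<Rightarrow> real"
  assumes "open I" "u \<in> I" "\<And>s. s \<in> I \<Longrightarrow> \<rho> s = h s"
    and h: "\<And>s. (h has_real_derivative h' s) (at s)"
    and h': "(h' has_real_derivative d) (at u)"
  shows "deriv (deriv \<rho>) u = d"
proof -
  have "deriv \<rho> s = h' s" if "s \<in> I" for s
    by (rule DERIV_imp_deriv, rule has_field_derivative_transform_within_open[OF h \<open>open I\<close> that])
       (simp add: assms(3))
  then show ?thesis
    by (intro DERIV_imp_deriv has_field_derivative_transform_within_open[OF h' \<open>open I\<close> \<open>u \<in> I\<close>])
       simp
qed

lemma first_integral:
  fixes h :: "real \<Rightarrow> real"
  assumes "is_interval I" "\<forall>u\<in>I. (h has_real_derivative 0) (at u)"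
  shows "\<exists>a. \<forall>u\<in>I. h u = a"
  by (rule has_field_derivative_zero_constant)
     (use assms in \<open>auto simp: is_interval_convex_1 intro: DERIV_subset\<close>)

text \<open>The first integrals here are \<open>(\<rho>' + C \<rho>) exp (- C u)\<close> and \<open>(\<rho>' - C \<rho>) exp (C u)\<close>.\<close>

lemma second_order_exp_iff:
  assumes "open I" "is_interval I" "smooth_fun_on I \<rho>" "C \<noteq> 0"
  shows "(\<forall>u\<in>I. deriv (deriv \<rho>) u = C\<^sup>2 * \<rho> u) \<longleftrightarrow>
    (\<exists>C\<^sub>1 C\<^sub>2. \<forall>u\<in>I. \<rho> u = C\<^sub>1 * exp (C * u) + C\<^sub>2 * exp (- C * u))"
proof
  assume ode: "\<forall>u\<in>I. deriv (deriv \<rho>) u = C\<^sup>2 * \<rho> u"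
  note D = smooth_fun_on_derivs[OF assms(3)]
  have "\<forall>u\<in>I. ((\<lambda>u. (deriv \<rho> u + C * \<rho> u) * exp (- C * u)) has_real_derivative 0) (at u)"
    using ode
    by (auto intro!: derivative_eq_intros D simp: algebra_simps power2_eq_square)
  from first_integral[OF assms(2) this] obtain a where
    a: "\<And>u. u \<in> I \<Longrightarrow> (deriv \<rho> u + C * \<rho> u) * exp (- C * u) = a"
    by blast
  have "\<forall>u\<in>I. ((\<lambda>u. (deriv \<rho> u - C * \<rho> u) * exp (C * u)) has_real_derivative 0) (at u)"
    using ode
    by (auto intro!: derivative_eq_intros D simp: algebra_simps power2_eq_square)
  from first_integral[OF assms(2) this] obtain b where
    b: "\<And>u. u \<in> I \<Longrightarrow> (deriv \<rho> u - C * \<rho> u) * exp (C * u) = b"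
    by blast
  have "\<rho> u = a / (2 * C) * exp (C * u) + (- b / (2 * C)) * exp (- C * u)" if "u \<in> I" for u
  proof -
    have inv: "exp (- C * u) * exp (C * u) = 1"
      by (simp flip: exp_add)
    have "a * exp (C * u) - b * exp (- C * u) =
        (deriv \<rho> u + C * \<rho> u) * (exp (- C * u) * exp (C * u)) -
        (deriv \<rho> u - C * \<rho> u) * (exp (- C * u) * exp (C * u))"
      unfolding a[OF that, symmetric] b[OF that, symmetric] by (simp only: mult_ac)
    also have "\<dots> = 2 * C * \<rho> u"
      unfolding inv by simp
    finally show ?thesis
      using assms(4) by (simp add: field_simps)
  qed
  then show "\<exists>C\<^sub>1 C\<^sub>2. \<forall>u\<in>I. \<rho> u = C\<^sub>1 * exp (C * u) + C\<^sub>2 * exp (- C * u)"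
    by blast
next
  assume "\<exists>C\<^sub>1 C\<^sub>2. \<forall>u\<in>I. \<rho> u = C\<^sub>1 * exp (C * u) + C\<^sub>2 * exp (- C * u)"
  then obtain C\<^sub>1 C\<^sub>2 where sol: "\<And>u. u \<in> I \<Longrightarrow> \<rho> u = C\<^sub>1 * exp (C * u) + C\<^sub>2 * exp (- C * u)"
    by blast
  show "\<forall>u\<in>I. deriv (deriv \<rho>) u = C\<^sup>2 * \<rho> u"
  proof
    fix u assume "u \<in> I"
    show "deriv (deriv \<rho>) u = C\<^sup>2 * \<rho> u"
      by (rule deriv_deriv_eq_on_open[OF assms(1) \<open>u \<in> I\<close> sol,
            where h' = "\<lambda>u. C * (C\<^sub>1 * exp (C * u) - C\<^sub>2 * exp (- C * u))"])
         (auto intro!: derivative_eq_intros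
            simp: sol[OF \<open>u \<in> I\<close>] algebra_simps power2_eq_square)
  qed
qed

text \<open>The first integrals here are \<open>C \<rho> sin (C u) + \<rho>' cos (C u)\<close> and
  \<open>C \<rho> cos (C u) - \<rho>' sin (C u)\<close>.\<close>

lemma second_order_trig_iff:
  assumes "open I" "is_interval I" "smooth_fun_on I \<rho>" "C \<noteq> 0"
  shows "(\<forall>u\<in>I. deriv (deriv \<rho>) u = - C\<^sup>2 * \<rho> u) \<longleftrightarrow>
    (\<exists>C\<^sub>1 C\<^sub>2. \<forall>u\<in>I. \<rho> u = C\<^sub>1 * sin (C * u) + C\<^sub>2 * cos (C * u))"
proof
  assume ode: "\<forall>u\<in>I. deriv (deriv \<rho>) u = - C\<^sup>2 * \<rho> u"
  note D = smooth_fun_on_derivs[OF assms(3)]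
  have "\<forall>u\<in>I. ((\<lambda>u. C * \<rho> u * sin (C * u) + deriv \<rho> u * cos (C * u)) has_real_derivative 0) (at u)"
    using ode
    by (auto intro!: derivative_eq_intros D simp: algebra_simps power2_eq_square)
  from first_integral[OF assms(2) this] obtain a where
    a: "\<And>u. u \<in> I \<Longrightarrow> C * \<rho> u * sin (C * u) + deriv \<rho> u * cos (C * u) = a"
    by blast
  have "\<forall>u\<in>I. ((\<lambda>u. C * \<rho> u * cos (C * u) - deriv \<rho> u * sin (C * u)) has_real_derivative 0) (at u)"
    using ode
    by (auto intro!: derivative_eq_intros D simp: algebra_simps power2_eq_square)
  from first_integral[OF assms(2) this] obtain b where
    b: "\<And>u. u \<in> I \<Longrightarrow> C * \<rho> u * cos (C * u) - deriv \<rho> u * sin (C * u) = b"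
    by blast
  have "\<rho> u = a / C * sin (C * u) + b / C * cos (C * u)" if "u \<in> I" for u
  proof -
    have "a * sin (C * u) + b * cos (C * u) = C * \<rho> u * ((sin (C * u))\<^sup>2 + (cos (C * u))\<^sup>2)"
      unfolding a[OF that, symmetric] b[OF that, symmetric] by algebra
    then have "a * sin (C * u) + b * cos (C * u) = C * \<rho> u"
      by simp
    then show ?thesis
      using assms(4) by (simp add: field_simps)
  qed
  then show "\<exists>C\<^sub>1 C\<^sub>2. \<forall>u\<in>I. \<rho> u = C\<^sub>1 * sin (C * u) + C\<^sub>2 * cos (C * u)"
    by blast
next
  assume "\<exists>C\<^sub>1 C\<^sub>2. \<forall>u\<in>I. \<rho> u = C\<^sub>1 * sin (C * u) + C\<^sub>2 * cos (C * u)"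
  then obtain C\<^sub>1 C\<^sub>2 where sol: "\<And>u. u \<in> I \<Longrightarrow> \<rho> u = C\<^sub>1 * sin (C * u) + C\<^sub>2 * cos (C * u)"
    by blast
  show "\<forall>u\<in>I. deriv (deriv \<rho>) u = - C\<^sup>2 * \<rho> u"
  proof
    fix u assume "u \<in> I"
    show "deriv (deriv \<rho>) u = - C\<^sup>2 * \<rho> u"
      by (rule deriv_deriv_eq_on_open[OF assms(1) \<open>u \<in> I\<close> sol,
            where h' = "\<lambda>u. C * (C\<^sub>1 * cos (C * u) - C\<^sub>2 * sin (C * u))"])
         (auto intro!: derivative_eq_intros
            simp: sol[OF \<open>u \<in> I\<close>] algebra_simps power2_eq_square)
  qed
qed

lemma second_order_affine_iff:
  assumes "open I" "is_interval I" "smooth_fun_on I \<rho>"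
  shows "(\<forall>u\<in>I. deriv (deriv \<rho>) u = 0) \<longleftrightarrow> (\<exists>C\<^sub>1 C\<^sub>2. \<forall>u\<in>I. \<rho> u = C\<^sub>1 * u + C\<^sub>2)"
proof
  assume ode: "\<forall>u\<in>I. deriv (deriv \<rho>) u = 0"
  note D = smooth_fun_on_derivs[OF assms(3)]
  have "\<forall>u\<in>I. (deriv \<rho> has_real_derivative 0) (at u)"
    using D(2) ode by fastforce
  from first_integral[OF assms(2) this] obtain a where
    a: "\<And>u. u \<in> I \<Longrightarrow> deriv \<rho> u = a"
    by blast
  have "\<forall>u\<in>I. ((\<lambda>u. \<rho> u - a * u) has_real_derivative 0) (at u)"
    by (auto intro!: derivative_eq_intros D simp: a)
  from first_integral[OF assms(2) this] obtain b where "\<And>u. u \<in> I \<Longrightarrow> \<rho> u - a * u = b"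
    by blast
  then have "\<forall>u\<in>I. \<rho> u = a * u + b"
    by (simp add: algebra_simps)
  then show "\<exists>C\<^sub>1 C\<^sub>2. \<forall>u\<in>I. \<rho> u = C\<^sub>1 * u + C\<^sub>2"
    by blast
next
  assume "\<exists>C\<^sub>1 C\<^sub>2. \<forall>u\<in>I. \<rho> u = C\<^sub>1 * u + C\<^sub>2"
  then obtain C\<^sub>1 C\<^sub>2 where sol: "\<And>u. u \<in> I \<Longrightarrow> \<rho> u = C\<^sub>1 * u + C\<^sub>2"
    by blast
  show "\<forall>u\<in>I. deriv (deriv \<rho>) u = 0"
  proof
    fix u assume "u \<in> I"
    show "deriv (deriv \<rho>) u = 0"
      by (rule deriv_deriv_eq_on_open[OF assms(1) \<open>u \<in> I\<close> sol, where h' = "\<lambda>_. C\<^sub>1"])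
         (auto intro!: derivative_eq_intros)
  qed
qed

theorem theorem3p1:
  fixes I :: "real set" and f g \<rho> :: "real \<Rightarrow> real" and K :: "real \<Rightarrow> real \<Rightarrow> real"
  assumes "open I" and "is_interval I"
    and "smooth_fun_on I f" and "smooth_fun_on I g" and "smooth_fun_on I \<rho>"
    and "\<And>u. u \<in> I \<Longrightarrow> (deriv f u)\<^sup>2 + (deriv g u)\<^sup>2 + (deriv \<rho> u)\<^sup>2 = 1"
    and "\<And>u. u \<in> I \<Longrightarrow> \<rho> u > 0"
    and "K = gaussian_curvature (SR1_surface f g \<rho>)"
  shows "((\<exists>k. \<forall>u\<in>I. \<forall>v\<in>{0..<2 * pi}. K u v = k) \<longleftrightarrow>
      (\<exists>C C\<^sub>1 C\<^sub>2. C \<noteq> 0 \<and> (\<forall>u\<in>I. \<rho> u = C\<^sub>1 * exp (C * u) + C\<^sub>2 * exp (- C * u) \<and> \<rho> u > 0)) \<or>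
      (\<exists>C C\<^sub>1 C\<^sub>2. C \<noteq> 0 \<and> (\<forall>u\<in>I. \<rho> u = C\<^sub>1 * sin (C * u) + C\<^sub>2 * cos (C * u) \<and> \<rho> u > 0)) \<or>
      (\<exists>C\<^sub>1 C\<^sub>2. \<forall>u\<in>I. \<rho> u = C\<^sub>1 * u + C\<^sub>2 \<and> \<rho> u > 0))
     \<and>
     (\<forall>C. C \<noteq> 0 \<longrightarrow>
      ((\<forall>u\<in>I. \<forall>v\<in>{0..<2 * pi}. K u v = - (C\<^sup>2)) \<longleftrightarrow>
       (\<exists>C\<^sub>1 C\<^sub>2. \<forall>u\<in>I. \<rho> u = C\<^sub>1 * exp (C * u) + C\<^sub>2 * exp (- C * u) \<and> \<rho> u > 0)))
     \<and>
     (\<forall>C. C \<noteq> 0 \<longrightarrow>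
      ((\<forall>u\<in>I. \<forall>v\<in>{0..<2 * pi}. K u v = C\<^sup>2) \<longleftrightarrow>
       (\<exists>C\<^sub>1 C\<^sub>2. \<forall>u\<in>I. \<rho> u = C\<^sub>1 * sin (C * u) + C\<^sub>2 * cos (C * u) \<and> \<rho> u > 0)))
     \<and>
     ((\<forall>u\<in>I. \<forall>v\<in>{0..<2 * pi}. K u v = 0) \<longleftrightarrow>
       (\<exists>C\<^sub>1 C\<^sub>2. \<forall>u\<in>I. \<rho> u = C\<^sub>1 * u + C\<^sub>2 \<and> \<rho> u > 0))"
proof -
  let ?const = "\<lambda>k. \<forall>u\<in>I. \<forall>v\<in>{0..<2 * pi}. K u v = k"
  let ?exp = "\<lambda>C. \<exists>C\<^sub>1 C\<^sub>2. \<forall>u\<in>I. \<rho> u = C\<^sub>1 * exp (C * u) + C\<^sub>2 * exp (- C * u) \<and> \<rho> u > 0"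
  let ?trig = "\<lambda>C. \<exists>C\<^sub>1 C\<^sub>2. \<forall>u\<in>I. \<rho> u = C\<^sub>1 * sin (C * u) + C\<^sub>2 * cos (C * u) \<and> \<rho> u > 0"
  let ?affine = "\<exists>C\<^sub>1 C\<^sub>2. \<forall>u\<in>I. \<rho> u = C\<^sub>1 * u + C\<^sub>2 \<and> \<rho> u > 0"
  have K: "K u v = - deriv (deriv \<rho>) u / \<rho> u" if "u \<in> I" for u v
    using SR1_gaussian_curvature[OF assms(1) that assms(3-7)] assms(8) by simp
  \<comment> \<open>\<open>K\<close> does not depend on the angle, so its value at \<open>v = 0\<close> decides.\<close>
  have ode: "?const k \<longleftrightarrow> (\<forall>u\<in>I. deriv (deriv \<rho>) u = - k * \<rho> u)" for k
  proof -
    have "(\<forall>v\<in>{0..<2 * pi}. K u v = k) \<longleftrightarrow> deriv (deriv \<rho>) u = - k * \<rho> u" if "u \<in> I" for u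
    proof -
      have "(\<forall>v\<in>{0..<2 * pi}. K u v = k) \<longleftrightarrow> - deriv (deriv \<rho>) u / \<rho> u = k"
        using K[OF that] by (auto dest: bspec[where x = 0])
      also have "\<dots> \<longleftrightarrow> deriv (deriv \<rho>) u = - k * \<rho> u"
        using assms(7)[OF that] by (auto simp: field_simps)
      finally show ?thesis .
    qed
    then show ?thesis by simp
  qed
  have exp: "?const (- (C\<^sup>2)) \<longleftrightarrow> ?exp C" if "C \<noteq> 0" for C
    using ode[of "- (C\<^sup>2)"] second_order_exp_iff[OF assms(1,2,5) that] assms(7) by simp
  have trig: "?const (C\<^sup>2) \<longleftrightarrow> ?trig C" if "C \<noteq> 0" for C
    using ode[of "C\<^sup>2"] second_order_trig_iff[OF assms(1,2,5) that] assms(7) by simp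
  have affine: "?const 0 \<longleftrightarrow> ?affine"
    using ode[of 0] second_order_affine_iff[OF assms(1,2,5)] assms(7) by simp
  have "(\<exists>k. ?const k) \<longleftrightarrow> (\<exists>C. C \<noteq> 0 \<and> ?exp C) \<or> (\<exists>C. C \<noteq> 0 \<and> ?trig C) \<or> ?affine"
  proof
    assume "\<exists>k. ?const k"
    then obtain k where k: "?const k" by blast
    consider "k < 0" | "k > 0" | "k = 0" by linarith
    then show "(\<exists>C. C \<noteq> 0 \<and> ?exp C) \<or> (\<exists>C. C \<noteq> 0 \<and> ?trig C) \<or> ?affine"
    proof cases
      case 1
      then have "sqrt (- k) \<noteq> 0" "k = - ((sqrt (- k))\<^sup>2)" by simp_all
      then show ?thesis using k exp by metis
    next
      case 2
      then have "sqrt k \<noteq> 0" "k = (sqrt k)\<^sup>2" by simp_all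
      then show ?thesis using k trig by metis
    next
      case 3
      then show ?thesis using k affine by blast
    qed
  next
    assume "(\<exists>C. C \<noteq> 0 \<and> ?exp C) \<or> (\<exists>C. C \<noteq> 0 \<and> ?trig C) \<or> ?affine"
    then show "\<exists>k. ?const k"
      using exp trig affine by metis
  qed
  then have "(\<exists>k. ?const k) \<longleftrightarrow>
      (\<exists>C C\<^sub>1 C\<^sub>2. C \<noteq> 0 \<and> (\<forall>u\<in>I. \<rho> u = C\<^sub>1 * exp (C * u) + C\<^sub>2 * exp (- C * u) \<and> \<rho> u > 0)) \<or>
      (\<exists>C C\<^sub>1 C\<^sub>2. C \<noteq> 0 \<and> (\<forall>u\<in>I. \<rho> u = C\<^sub>1 * sin (C * u) + C\<^sub>2 * cos (C * u) \<and> \<rho> u > 0)) \<or>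
      ?affine"
    by (simp only: ex_simps)
  then show ?thesis
    using exp trig affine by (intro conjI allI impI)
qed

end
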